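(* Let $f(x)=\frac{x(2+\cos x)}{\sin x}$ for $0<x<\frac{\pi}{2}$. Then $f$ is a strictly increasing function. In particular, one has $$\frac{2+\cos x}{\pi}<\frac{\sin x}{x}<\frac{2+\cos x}{3},\qquad 0<x<\frac{\pi}{2}.$$ *)

theory Defs
  imports Complex_Main
begin

end

theory Submission
  imports Defs "HOL-Real_Asymp.Real_Asymp"
begin

text \<open>
  The derivative of \<open>x (2 + cos x) / sin x\<close> is \<open>N x / (sin x)\<^sup>2\<close> with
  \<open>N x = 2 sin x + sin x cos x - x - 2 x cos x\<close>. Here \<open>N 0 = 0\<close> and
  \<open>N' x = 2 sin x (x - sin x) > 0\<close>, so the quotient is strictly increasing. The bounds are
  its limit \<open>3\<close> at \<open>0\<close> and its value \<open>\<pi>\<close> at \<open>\<pi> / 2\<close>.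
\<close>

lemma sin_less_self:
  fixes x :: real
  assumes "0 < x" "x < pi"
  shows "sin x < x"
proof -
  have "(\<lambda>t. t - sin t) 0 < (\<lambda>t. t - sin t) x"
  \<comment> \<open>The derivative \<open>1 - cos t\<close> vanishes at 0, so positivity can only be
    claimed in the open interval; continuity covers the endpoints.\<close>
  proof (rule DERIV_pos_imp_increasing_open[OF assms(1)])
    fix t :: real
    assume t: "0 < t" "t < x"
    have "((\<lambda>t. t - sin t) has_real_derivative 1 - cos t) (at t)"
      by (auto intro!: derivative_eq_intros)
    moreover have "cos t < 1"
      using cos_monotone_0_pi[of 0 t] t assms by simp
    ultimately show "\<exists>y. ((\<lambda>t. t - sin t) has_real_derivative y) (at t) \<and> 0 < y"
      by force
  qed (intro continuous_intros)
  then show ?thesis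
    by simp
qed

lemma numerator_pos:
  fixes x :: real
  assumes "0 < x" "x < pi"
  shows "0 < 2 * sin x + sin x * cos x - x - 2 * x * cos x"
proof -
  let ?N = "\<lambda>t::real. 2 * sin t + sin t * cos t - t - 2 * t * cos t"
  have "?N 0 < ?N x"
  proof (rule DERIV_pos_imp_increasing_open[OF assms(1)])
    fix t :: real
    assume t: "0 < t" "t < x"
    have "(?N has_real_derivative
        2 * cos t + (cos t * cos t - sin t * sin t) - 1 - (2 * cos t - 2 * t * sin t)) (at t)"
      by (auto intro!: derivative_eq_intros simp: algebra_simps)
    \<comment> \<open>The terms \<open>2 * cos t\<close> cancel, and cos^2 - 1 = -sin^2 leaves 2 t
      sin t - 2 sin^2 t.\<close>
    also have "2 * cos t + (cos t * cos t - sin t * sin t) - 1 - (2 * cos t - 2 * t * sin t)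
        = 2 * sin t * (t - sin t)"
      using sin_cos_squared_add3[of t] by (simp add: algebra_simps)
    finally have "(?N has_real_derivative 2 * sin t * (t - sin t)) (at t)" .
    moreover have "0 < 2 * sin t * (t - sin t)"
      using sin_gt_zero[of t] sin_less_self[of t] t assms by simp
    ultimately show "\<exists>y. (?N has_real_derivative y) (at t) \<and> 0 < y"
      by blast
  qed (intro continuous_intros)
  then show ?thesis
    by simp
qed

text \<open>Working on (0, pi) makes pi / 2 an interior point, so the value there can be compared
  directly, without a limit from the left.\<close>

lemma quotient_strict_mono_on:
  "strict_mono_on {0<..<pi} (\<lambda>x::real. x * (2 + cos x) / sin x)"
proof (rule strict_mono_onI)
  fix x y :: real
  assume xy: "x \<in> {0<..<pi}" "y \<in> {0<..<pi}" "x < y"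
  let ?f = "\<lambda>x::real. x * (2 + cos x) / sin x"
  show "?f x < ?f y"
  proof (rule DERIV_pos_imp_increasing[OF xy(3)])
    fix t :: real
    assume "x \<le> t" "t \<le> y"
    then have t: "0 < t" "t < pi"
      using xy by auto
    then have s: "sin t > 0"
      by (rule sin_gt_zero)
    have "(?f has_real_derivative
        ((2 + cos t - t * sin t) * sin t - t * (2 + cos t) * cos t) / (sin t * sin t)) (at t)"
      using s by (auto intro!: derivative_eq_intros simp: algebra_simps)
    \<comment> \<open>Grouping the two terms in t cos^2 and t sin^2 exposes the factor cos^2 + sin^2
      = 1.\<close>
    also have "(2 + cos t - t * sin t) * sin t - t * (2 + cos t) * cos t
        = 2 * sin t + sin t * cos t - t * (cos t * cos t + sin t * sin t) - 2 * t * cos t"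
      by algebra
    also have "\<dots> = 2 * sin t + sin t * cos t - t - 2 * t * cos t"
      by (simp only: sin_cos_squared_add3 mult_1_right)
    finally show "\<exists>d. (?f has_real_derivative d) (at t) \<and> 0 < d"
      using numerator_pos[OF t] s by (meson divide_pos_pos mult_pos_pos)
  qed
qed

theorem theorem1:
  shows "strict_mono_on {0<..<pi / 2} (\<lambda>x::real. x * (2 + cos x) / sin x)
    \<and> (\<forall>x::real. 0 < x \<and> x < pi / 2 \<longrightarrow>
          (2 + cos x) / pi < sin x / x \<and> sin x / x < (2 + cos x) / 3)"
proof (intro conjI allI impI)
  let ?f = "\<lambda>x::real. x * (2 + cos x) / sin x"
  show "strict_mono_on {0<..<pi / 2} ?f"
    using quotient_strict_mono_on by (rule monotone_on_subset) auto
  fix x :: real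
  assume x: "0 < x \<and> x < pi / 2"
  then have s: "sin x > 0"
    by (intro sin_gt_zero) auto
  have mono: "?f a < ?f b" if "0 < a" "a < b" "b < pi" for a b
    using strict_mono_onD[OF quotient_strict_mono_on, of a b] that by simp
  \<comment> \<open>The right-hand side equals pi, since cos (pi / 2) = 0 and sin (pi / 2) =
    1.\<close>
  have "?f x < ?f (pi / 2)"
    using x by (intro mono) auto
  then show "(2 + cos x) / pi < sin x / x"
    using x s by (simp add: field_simps)
  have "(?f \<longlongrightarrow> 3) (at_right 0)"
    by real_asymp
  \<comment> \<open>Passing to the limit keeps only a weak inequality. Bounding by the value at the
    intermediate point \<open>x / 2\<close> lets the later step from \<open>x / 2\<close> to
    \<open>x\<close> restore strictness.\<close>
  moreover have "\<forall>\<^sub>F y in at_right 0. ?f y \<le> ?f (x / 2)"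
    unfolding eventually_at_right_field
  proof (intro exI[of _ "x / 2"] conjI allI impI)
    fix y assume "0 < y" "y < x / 2"
    with x show "?f y \<le> ?f (x / 2)"
      by (intro less_imp_le[OF mono]) auto
  qed (use x in simp)
  ultimately have "3 \<le> ?f (x / 2)"
    by (rule tendsto_upperbound) simp
  also have "\<dots> < ?f x"
    using x by (intro mono) auto
  finally show "sin x / x < (2 + cos x) / 3"
    using x s by (simp add: field_simps)
qed

end
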